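(* Suppose $f$ and $\Psi$ are convex, and let $\{x^k\}$ be generated by the RNBPG method with $M=0$. Suppose that there exists $\tau>0$ such that $$\mathrm{dist}(x^k,X^* )\le\tau\|\hat g^k\|\qquad\forall k\ge0,$$ where $\hat g^k=\arg\min_d\{\nabla f(x^k)^Td+\frac12\|d\|^2+\Psi(x^k+d)\}$ and $X^*$ denotes the set of optimal solutions of $\min_xF(x)$. Then $$\mathbf{E}_{\xi_k}[F(x^k)]-F^*\le\left[\frac{2\varpi+(1-p_{\min})\sigma}{2\varpi+\sigma}\right]^k(F(x^0)-F^* )\qquad\forall k\ge0,$$ where $F^*$ is the optimal value and $$\varpi=\frac{(c+L_f)\tau^2c^2}{8}\left[1+\frac{1}{\underline\theta}+\sqrt{1-\frac2c+\frac{1}{\underline\theta^2}}\,\right]^2+\frac{L_{\max}-\underline\theta}{2}.$$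
   Context: **Problem.** $x\in\mathbb{R}^N$ is partitioned into blocks $x=(x_1,\dots,x_n)$, $x_i\in\mathbb{R}^{N_i}$. Consider $\min_{x\in\mathbb{R}^N}\{F(x):=f(x)+\Psi(x)\}$ with $\Psi(x)=\sum_{i=1}^n\Psi_i(x_i)$. The function $f:\mathbb{R}^N\to\mathbb{R}$ is differentiable, and $\Psi_i:\mathbb{R}^{N_i}\to\mathbb{R}\cup\{+\infty\}$. $\|\cdot\|$ is the Euclidean norm, $\nabla_i f$ is the partial gradient with respect to $x_i$, and there are constants $L_i>0$ with $\|\nabla_i f(x+h)-\nabla_i f(x)\|\le L_i\|h\|$ for all $x\in\mathbb{R}^N$, all $i$, and all $h=(h_1,\dots,h_n)$ with $h_j=0$ for all $j\ne i$. Put $L_f=\sum_iL_i$, $L_{\max}=\max_iL_i$. The set $X^*$ of optimal solutions is nonempty, with optimal value $F^*$; $\mathrm{dom}(F)=\{x:F(x)<+\infty\}$; $\mathrm{dist}(x,S)$ is the Euclidean distance from $x$ to $S$. **RNBPG method with $M=0$.** Choose $x^0\in\mathrm{dom}(F)$, $\eta>1$, $\sigma>0$, $0<\underline\theta\le\bar\theta$, and $0<p_i<1$ with $\sum_{i=1}^n p_i=1$. For $k=0,1,2,\dots$: 1) Set $d^k=0$. Pick $i_k=i\in\{1,\dots,n\}$ with probability $p_i$. Choose $\theta_k^0\in[\underline\theta,\bar\theta]$. 2) For $j=0,1,\dots$: let $\theta_k=\theta_k^0\eta^j$, compute the $i_k$-th block of $d^k$ (the other blocks being $0$) as $(d^k)_{i_k}=\arg\min_s\{\nabla_{i_k}f(x^k)^Ts+\frac{\theta_k}{2}\|s\|^2+\Psi_{i_k}(x^k_{i_k}+s)\}$;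 if $F(x^k+d^k)\le F(x^k)-\frac{\sigma}{2}\|d^k\|^2$, stop the inner loop. 3) Set $x^{k+1}=x^k+d^k$. $\arg\min$ denotes a minimizer (assumed to exist). **Randomness.** The $i_k$ are drawn independently; $\xi_k=\{i_0,\dots,i_k\}$, and $\mathbf{E}_{\xi_k}$ is expectation with respect to $\xi_k$. All other choices (such as $\theta^0_k$) are determined by the realized indices, so $x^k$ is a function of $\xi_{k-1}$ and $d^k$ is a function of $\xi_k$. The error bound hypothesis is required for all realizations, with the same $\tau$. **Constants.** $p_{\min}=\min_ip_i$, $c=\max\{\bar\theta,\eta(L_{\max}+\sigma)\}$.
   Formalization: The formal theorem additionally assumes ϖ ≥ 0; without it the claimed rate can fail (e.g. n=16, f=(Σx_i)²/16, Ψ=0, p_i=1/16, θ=1, η=2, σ=0.135, τ=1/2 gives ϖ<0 and a false bound) or have denominator 2ϖ+σ = 0. *)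

theory Defs
  imports "HOL-Probability.Probability"
begin

text \<open>
  The block structure of \<open>real ^ 'm\<close> is a map \<open>b\<close> sending each coordinate to the block that
  contains it; an index outside the range of \<open>b\<close> is a block of dimension 0. A vector of the
  i-th block space is represented by its zero-padded version in \<open>real ^ 'm\<close>, which has
  the same norm and inner products.
\<close>

definition block_space :: "('m \<Rightarrow> 'n) \<Rightarrow> 'n \<Rightarrow> (real ^ 'm) set" where
  "block_space b i = {v. \<forall>j. b j \<noteq> i \<longrightarrow> v $ j = 0}"

definition block :: "('m \<Rightarrow> 'n) \<Rightarrow> 'n \<Rightarrow> real ^ 'm \<Rightarrow> real ^ 'm" where
  "block b i x = (\<chi> j. if b j = i then x $ j else 0)"

text \<open>Only the values of \<open>\<Psi> i\<close> on \<open>block_space b i\<close> are ever used.\<close>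

definition separable ::
    "('m \<Rightarrow> 'n::finite) \<Rightarrow> ('n \<Rightarrow> real ^ 'm \<Rightarrow> ereal) \<Rightarrow> real ^ 'm \<Rightarrow> ereal" where
  "separable b \<Psi> x = (\<Sum>i\<in>UNIV. \<Psi> i (block b i x))"

definition composite ::
    "(real ^ 'm \<Rightarrow> real) \<Rightarrow> (real ^ 'm \<Rightarrow> ereal) \<Rightarrow> real ^ 'm \<Rightarrow> ereal" where
  "composite f P x = ereal (f x) + P x"

text \<open>Meant for functions that never take the value \<open>-\<infinity>\<close>.\<close>

definition ereal_convex :: "('a::real_vector \<Rightarrow> ereal) \<Rightarrow> bool" where
  "ereal_convex g \<longleftrightarrow>
     (\<forall>x y. \<forall>t\<in>{0<..<1}.
        g ((1 - t) *\<^sub>R x + t *\<^sub>R y) \<le> ereal (1 - t) * g x + ereal t * g y)"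

definition minimizers :: "('a \<Rightarrow> ereal) \<Rightarrow> 'a set" where
  "minimizers F = {x. is_arg_min F (\<lambda>_. True) x}"

definition optimal_value :: "('a \<Rightarrow> ereal) \<Rightarrow> ereal" where
  "optimal_value F = (INF x. F x)"

definition is_block_direction ::
    "('m \<Rightarrow> 'n) \<Rightarrow> (real ^ 'm \<Rightarrow> real ^ 'm) \<Rightarrow> ('n \<Rightarrow> real ^ 'm \<Rightarrow> ereal)
     \<Rightarrow> real \<Rightarrow> real ^ 'm \<Rightarrow> 'n \<Rightarrow> real ^ 'm::finite \<Rightarrow> bool" where
  "is_block_direction b grad \<Psi> \<theta> x i d \<longleftrightarrow>
     is_arg_min
       (\<lambda>s. ereal (block b i (grad x) \<bullet> s + \<theta> / 2 * (norm s)\<^sup>2) + \<Psi> i (block b i x + s))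
       (\<lambda>s. s \<in> block_space b i) d"

definition is_prox_direction ::
    "(real ^ 'm \<Rightarrow> real ^ 'm) \<Rightarrow> (real ^ 'm \<Rightarrow> ereal) \<Rightarrow> real ^ 'm \<Rightarrow> real ^ 'm::finite \<Rightarrow> bool"
  where
  "is_prox_direction grad P x g \<longleftrightarrow>
     is_arg_min (\<lambda>d. ereal (grad x \<bullet> d + 1 / 2 * (norm d)\<^sup>2) + P (x + d)) (\<lambda>_. True) g"

definition sufficient_decrease ::
    "(real ^ 'm \<Rightarrow> ereal) \<Rightarrow> real \<Rightarrow> real ^ 'm \<Rightarrow> real ^ 'm::finite \<Rightarrow> bool" where
  "sufficient_decrease F \<sigma> x d \<longleftrightarrow> F (x + d) \<le> F x - ereal (\<sigma> / 2 * (norm d)\<^sup>2)"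

text \<open>
  One iteration from \<open>x\<close> to \<open>x'\<close> once block \<open>i\<close> has been drawn: \<open>\<theta>\<^sub>0\<close> is the
  initial trial value, \<open>d j\<close> the direction of the j-th inner trial, and \<open>J\<close> the first
  trial that passes the test.
\<close>

definition rnbpg_step ::
    "('m \<Rightarrow> 'n::finite) \<Rightarrow> (real ^ 'm \<Rightarrow> real) \<Rightarrow> (real ^ 'm \<Rightarrow> real ^ 'm)
     \<Rightarrow> ('n \<Rightarrow> real ^ 'm \<Rightarrow> ereal) \<Rightarrow> real \<Rightarrow> real \<Rightarrow> real \<Rightarrow> real
     \<Rightarrow> real ^ 'm \<Rightarrow> 'n \<Rightarrow> real ^ 'm::finite \<Rightarrow> bool" where
  "rnbpg_step b f grad \<Psi> \<eta> \<sigma> \<theta>lo \<theta>hi x i x' \<longleftrightarrow>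
     (\<exists>\<theta>\<^sub>0\<in>{\<theta>lo..\<theta>hi}. \<exists>J::nat. \<exists>d::nat \<Rightarrow> real ^ 'm.
        (\<forall>j\<le>J. is_block_direction b grad \<Psi> (\<theta>\<^sub>0 * \<eta> ^ j) x i (d j)) \<and>
        (\<forall>j<J. \<not> sufficient_decrease (composite f (separable b \<Psi>)) \<sigma> x (d j)) \<and>
        sufficient_decrease (composite f (separable b \<Psi>)) \<sigma> x (d J) \<and>
        x' = x + d J)"

text \<open>
  The iterates are indexed by the history of drawn blocks, in chronological order:
  \<open>x [i\<^sub>0, \<dots>, i\<^sub>k\<^sub>-\<^sub>1]\<close> is the k-th iterate. All choices other than the
  blocks are thereby functions of the history.
\<close>

definition rnbpg_iterates ::
    "('m \<Rightarrow> 'n::finite) \<Rightarrow> (real ^ 'm \<Rightarrow> real) \<Rightarrow> (real ^ 'm \<Rightarrow> real ^ 'm)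
     \<Rightarrow> ('n \<Rightarrow> real ^ 'm \<Rightarrow> ereal) \<Rightarrow> real \<Rightarrow> real \<Rightarrow> real \<Rightarrow> real
     \<Rightarrow> ('n list \<Rightarrow> real ^ 'm::finite) \<Rightarrow> bool" where
  "rnbpg_iterates b f grad \<Psi> \<eta> \<sigma> \<theta>lo \<theta>hi x \<longleftrightarrow>
     composite f (separable b \<Psi>) (x []) < \<infinity> \<and>
     (\<forall>h i. rnbpg_step b f grad \<Psi> \<eta> \<sigma> \<theta>lo \<theta>hi (x h) i (x (h @ [i])))"

definition rnbpg_varpi :: "real \<Rightarrow> real \<Rightarrow> real \<Rightarrow> real \<Rightarrow> real \<Rightarrow> real" where
  "rnbpg_varpi c Lf Lmax \<tau> \<theta>lo =
     (c + Lf) * \<tau>\<^sup>2 * c\<^sup>2 / 8 * (1 + 1 / \<theta>lo + sqrt (1 - 2 / c + 1 / \<theta>lo\<^sup>2))\<^sup>2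
     + (Lmax - \<theta>lo) / 2"

end

theory Submission
  imports Defs
begin

text \<open>
  Fix an iterate \<open>x\<close> of finite value. For every block \<open>i\<close> that could be drawn, let \<open>d i\<close> be the
  direction that would be accepted and \<open>\<theta> i\<close> its parameter. A trial with
  \<open>\<theta> \<ge> L i + \<sigma>\<close> is always accepted (\<open>trial_accepted\<close>), so \<open>\<theta>lo \<le> \<theta> i \<le> c\<close>. Let \<open>D\<close> be the sum of
  the \<open>\<parallel>d i\<parallel>\<^sup>2\<close>, \<open>a i\<close> the decrease of \<open>F\<close> from \<open>x\<close> to \<open>x + d i\<close>, and \<open>A\<close> the sum of the \<open>a i\<close>.
  The total \<open>A\<close> has two lower bounds.

  \<^item> The acceptance test gives \<open>A \<ge> \<sigma> / 2 * D\<close>.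
  \<^item> The block descent lemma bounds \<open>a i\<close> below by the decrease of the block model, up to
    \<open>(Lmax - \<theta>lo) / 2 * \<parallel>d i\<parallel>\<^sup>2\<close>. The block models are minimized by the \<open>d i\<close>; comparing with
    the blocks of \<open>y - x\<close> for an optimal \<open>y\<close> and using the gradient inequality, the model
    decreases add up to at least \<open>F x - F* - c / 2 * \<parallel>y - x\<parallel>\<^sup>2\<close>. Taking the infimum over
    \<open>y\<close> turns the norm into the distance to the optimal set, which the error bound controls by
    the full proximal direction \<open>g\<close>. Hence \<open>A \<ge> F x - F* - varpi * D\<close>
    (\<open>sum_block_decrease_ge\<close>).

  The link between \<open>g\<close> and the \<open>d i\<close> is \<open>\<parallel>g\<parallel>\<^sup>2 \<le> (max 1 c)\<^sup>2 * D\<close>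
  (\<open>norm_prox_direction_le\<close>): by separability the i-th block of \<open>g\<close> solves the same block problem
  as \<open>d i\<close> with parameter \<open>1\<close>, and two such solutions are compared by adding their variational
  inequalities. The bracket in \<open>varpi\<close>, multiplied by \<open>c / 2\<close>, is at least \<open>max 1 c\<close>
  (\<open>rnbpg_varpi_ge\<close>).

  Eliminating \<open>D\<close> gives \<open>A \<ge> \<sigma> / (2 * varpi + \<sigma>) * (F x - F*)\<close>. The expected decrease of one
  iteration is at least \<open>pmin * A\<close>, which yields the contraction factor of the theorem
  (\<open>weighted_sum_le_contraction\<close>). Since the block draws are independent, the expectation of a
  function of the first \<open>k\<close> draws is a finite sum over histories, weighted by products of
  probabilities, and the contraction is iterated there.
\<close>

section \<open>Block decomposition of a vector\<close>

lemma block_in_space [simp]: "block b i x \<in> block_space b i"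
  by (simp add: block_def block_space_def)

lemma block_of_space: "v \<in> block_space b i \<Longrightarrow> block b j v = (if j = i then v else 0)"
  by (auto simp: block_def block_space_def vec_eq_iff)

lemma block_add: "block b i (x + y) = block b i x + block b i y"
  by (simp add: block_def vec_eq_iff)

lemma block_diff: "block b i (x - y) = block b i x - block b i y"
  by (simp add: block_def vec_eq_iff)

lemma zero_in_block_space [simp]: "0 \<in> block_space b i"
  by (simp add: block_space_def)

lemma block_space_add: "u \<in> block_space b i \<Longrightarrow> v \<in> block_space b i \<Longrightarrow> u + v \<in> block_space b i"
  by (simp add: block_space_def)

lemma block_space_diff: "u \<in> block_space b i \<Longrightarrow> v \<in> block_space b i \<Longrightarrow> u - v \<in> block_space b i"
  by (simp add: block_space_def)

lemma block_space_scaleR: "u \<in> block_space b i \<Longrightarrow> t *\<^sub>R u \<in> block_space b i"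
  by (simp add: block_space_def)

lemma inner_block: "d \<in> block_space b i \<Longrightarrow> block b i g \<bullet> d = g \<bullet> d"
  for b :: "'m::finite \<Rightarrow> 'n"
  unfolding inner_vec_def by (rule sum.cong) (auto simp: block_def block_space_def)

lemma sum_block: "(\<Sum>i\<in>UNIV. block b i x) = x"
  for b :: "'m::finite \<Rightarrow> 'n::finite"
  by (simp add: vec_eq_iff block_def)

lemma inner_sum_block: "(\<Sum>i\<in>UNIV. block b i x \<bullet> block b i y) = x \<bullet> y"
  for b :: "'m::finite \<Rightarrow> 'n::finite"
proof -
  have "(\<Sum>i\<in>UNIV. block b i x \<bullet> block b i y) = (\<Sum>i\<in>UNIV. x \<bullet> block b i y)"
    by (simp add: inner_block)
  also have "\<dots> = x \<bullet> y"
    by (simp add: inner_sum_right [symmetric] sum_block)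
  finally show ?thesis .
qed

lemma norm_sum_block: "(\<Sum>i\<in>UNIV. (norm (block b i x))\<^sup>2) = (norm x)\<^sup>2"
  for b :: "'m::finite \<Rightarrow> 'n::finite"
  by (simp add: power2_norm_eq_inner inner_sum_block)

section \<open>Gradients along lines\<close>

lemma GDERIV_along_line:
  assumes "GDERIV f (x + t *\<^sub>R d) :> g"
  shows "((\<lambda>t. f (x + t *\<^sub>R d)) has_real_derivative g \<bullet> d) (at t)"
proof -
  have "((\<lambda>t. f (x + t *\<^sub>R d)) has_derivative (\<lambda>h. (h *\<^sub>R d) \<bullet> g)) (at t)"
    using assms unfolding gderiv_def
    by (rule has_derivative_compose [rotated]) (auto intro!: derivative_eq_intros)
  then show ?thesis
    by (simp add: has_field_derivative_def inner_commute mult_commute_abs)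
qed

lemma convex_gradient_inequality:
  assumes f: "convex_on UNIV f" and grad: "GDERIV f x :> g"
  shows "f x + g \<bullet> (y - x) \<le> f y"
proof -
  let ?\<phi> = "\<lambda>t. f (x + t *\<^sub>R (y - x))"
  have "?\<phi> 1 - ?\<phi> 0 \<ge> (g \<bullet> (y - x)) * (1 - 0)"
  proof (rule convex_on_imp_above_tangent [of UNIV])
    show "convex_on UNIV ?\<phi>"
    proof (rule convex_onI)
      fix t u v :: real assume t: "0 < t" "t < 1"
      have "x + ((1 - t) *\<^sub>R u + t *\<^sub>R v) *\<^sub>R (y - x)
          = (1 - t) *\<^sub>R (x + u *\<^sub>R (y - x)) + t *\<^sub>R (x + v *\<^sub>R (y - x))"
        by (simp add: algebra_simps)
      then show "?\<phi> ((1 - t) *\<^sub>R u + t *\<^sub>R v) \<le> (1 - t) * ?\<phi> u + t * ?\<phi> v"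
        using convex_onD [OF f, of t "x + u *\<^sub>R (y - x)" "x + v *\<^sub>R (y - x)"] t by simp
    qed simp
    show "(?\<phi> has_field_derivative g \<bullet> (y - x)) (at 0 within UNIV)"
      using grad by (intro GDERIV_along_line) simp
  qed auto
  then show ?thesis by simp
qed

section \<open>Composite functions with a separable part\<close>

locale block_composite =
  fixes b :: "'m::finite \<Rightarrow> 'n::finite"
    and f :: "real ^ 'm \<Rightarrow> real"
    and grad :: "real ^ 'm \<Rightarrow> real ^ 'm"
    and \<Psi> :: "'n \<Rightarrow> real ^ 'm \<Rightarrow> ereal"
    and L :: "'n \<Rightarrow> real"
  assumes grad: "\<And>z. GDERIV f z :> grad z"
    and proper: "\<And>i v. v \<in> block_space b i \<Longrightarrow> \<Psi> i v \<noteq> -\<infinity>"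
    and lipschitz: "\<And>z i h. h \<in> block_space b i \<Longrightarrow>
          norm (block b i (grad (z + h)) - block b i (grad z)) \<le> L i * norm h"
    and convex_f: "convex_on UNIV f"
    and convex_\<Psi>: "ereal_convex (separable b \<Psi>)"
begin

abbreviation F :: "real ^ 'm \<Rightarrow> ereal" where
  "F \<equiv> composite f (separable b \<Psi>)"

abbreviation Fr :: "real ^ 'm \<Rightarrow> real" where
  "Fr z \<equiv> real_of_ereal (F z)"

abbreviation \<psi> :: "'n \<Rightarrow> real ^ 'm \<Rightarrow> real" where
  "\<psi> i v \<equiv> real_of_ereal (\<Psi> i v)"

text \<open>
  Along the segment from \<open>x\<close> to \<open>x + d\<close> the derivative of \<open>f\<close> involves only block \<open>i\<close> of the
  gradient, so blockwise Lipschitz continuity suffices: subtracting the quadratic model leaves a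
  nonincreasing function.
\<close>

lemma block_descent:
  assumes d: "d \<in> block_space b i"
  shows "f (x + d) \<le> f x + grad x \<bullet> d + L i / 2 * (norm d)\<^sup>2"
proof -
  let ?\<phi> = "\<lambda>t. f (x + t *\<^sub>R d) - t * (grad x \<bullet> d) - L i / 2 * t\<^sup>2 * (norm d)\<^sup>2"
  have "?\<phi> 1 \<le> ?\<phi> 0"
  proof (rule DERIV_nonpos_imp_nonincreasing [where f = ?\<phi>])
    fix t :: real assume t: "0 \<le> t" "t \<le> 1"
    have deriv: "(?\<phi> has_real_derivative
        grad (x + t *\<^sub>R d) \<bullet> d - grad x \<bullet> d - L i * t * (norm d)\<^sup>2) (at t)"
      using GDERIV_along_line [OF grad, where x = x and t = t and d = d]
      by (auto intro!: derivative_eq_intros)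
    have "(grad (x + t *\<^sub>R d) - grad x) \<bullet> d
        = (block b i (grad (x + t *\<^sub>R d)) - block b i (grad x)) \<bullet> d"
      by (simp add: inner_diff_left inner_block [OF d])
    also have "\<dots> \<le> norm (block b i (grad (x + t *\<^sub>R d)) - block b i (grad x)) * norm d"
      by (rule norm_cauchy_schwarz)
    also have "\<dots> \<le> L i * norm (t *\<^sub>R d) * norm d"
      by (intro mult_right_mono lipschitz block_space_scaleR d) simp
    also have "\<dots> = L i * t * (norm d)\<^sup>2"
      using t by (simp add: power2_eq_square)
    finally show "\<exists>y. (?\<phi> has_real_derivative y) (at t) \<and> y \<le> 0"
      using deriv by (auto simp: inner_diff_left)
  qed simp
  then show ?thesis by simp
qed

lemma \<Psi>_real: "v \<in> block_space b i \<Longrightarrow> \<Psi> i v \<noteq> \<infinity> \<Longrightarrow> \<Psi> i v = ereal (\<psi> i v)"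
  using proper [of v i] by (cases "\<Psi> i v") auto

lemma separable_finite_iff:
  "separable b \<Psi> z \<noteq> \<infinity> \<longleftrightarrow> (\<forall>i. \<Psi> i (block b i z) \<noteq> \<infinity>)"
  unfolding separable_def by (auto simp: sum_Pinfty)

lemma separable_real:
  assumes "\<And>i. \<Psi> i (block b i z) \<noteq> \<infinity>"
  shows "separable b \<Psi> z = ereal (\<Sum>i\<in>UNIV. \<psi> i (block b i z))"
  unfolding separable_def using \<Psi>_real [OF _ assms]
  by (simp flip: sum_ereal)

lemma F_finite_iff: "F z \<noteq> \<infinity> \<longleftrightarrow> (\<forall>i. \<Psi> i (block b i z) \<noteq> \<infinity>)"
  by (simp add: composite_def separable_finite_iff [symmetric])

lemma F_real:
  assumes "F z \<noteq> \<infinity>"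
  shows "F z = ereal (f z + (\<Sum>i\<in>UNIV. \<psi> i (block b i z)))"
  using assms separable_real [of z] by (simp add: F_finite_iff) (simp add: composite_def)

lemma Fr_eq: "F z \<noteq> \<infinity> \<Longrightarrow> Fr z = f z + (\<Sum>i\<in>UNIV. \<psi> i (block b i z))"
  by (simp add: F_real)

lemma block_shift:
  assumes "s \<in> block_space b i"
  shows "block b j (x + s) = (if j = i then block b i x + s else block b j x)"
  using assms by (auto simp: block_add block_of_space)

lemma F_shift_finite:
  assumes "F x \<noteq> \<infinity>" "s \<in> block_space b i" "\<Psi> i (block b i x + s) \<noteq> \<infinity>"
  shows "F (x + s) \<noteq> \<infinity>"
  using assms by (simp add: F_finite_iff block_shift [OF assms(2)])

lemma sum_shift:
  assumes "s \<in> block_space b i"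
  shows "(\<Sum>j\<in>UNIV. \<psi> j (block b j (x + s)))
       = (\<Sum>j\<in>UNIV. \<psi> j (block b j x)) + \<psi> i (block b i x + s) - \<psi> i (block b i x)"
proof -
  have "(\<Sum>j\<in>UNIV - {i}. \<psi> j (block b j (x + s))) = (\<Sum>j\<in>UNIV - {i}. \<psi> j (block b j x))"
    by (rule sum.cong) (auto simp: block_shift [OF assms])
  then show ?thesis
    by (simp add: sum.remove [of UNIV i] block_shift [OF assms])
qed

text \<open>
  Convexity is assumed for the whole sum only. It passes to a single summand by varying block \<open>i\<close>
  of a point of finite value: the other summands are then a finite constant.
\<close>

lemma \<Psi>_block_convex:
  assumes x: "F x \<noteq> \<infinity>"
    and u: "u \<in> block_space b i" "\<Psi> i u \<noteq> \<infinity>"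
    and v: "v \<in> block_space b i" "\<Psi> i v \<noteq> \<infinity>"
    and t: "0 < t" "t < 1"
  shows "\<Psi> i ((1 - t) *\<^sub>R u + t *\<^sub>R v) \<noteq> \<infinity>"
    and "\<psi> i ((1 - t) *\<^sub>R u + t *\<^sub>R v) \<le> (1 - t) * \<psi> i u + t * \<psi> i v"
proof -
  define w where "w = (1 - t) *\<^sub>R u + t *\<^sub>R v"
  define lift where "lift = (\<lambda>v. x + (v - block b i x))"
  define S where "S = (\<lambda>z. \<Sum>j\<in>UNIV. \<psi> j (block b j z))"
  have w: "w \<in> block_space b i"
    unfolding w_def by (intro block_space_add block_space_scaleR u v)
  have fin: "separable b \<Psi> (lift v) \<noteq> \<infinity> \<longleftrightarrow> \<Psi> i v \<noteq> \<infinity>" if "v \<in> block_space b i" for v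
    using x that by (auto simp: separable_finite_iff lift_def F_finite_iff
        block_shift [OF block_space_diff [OF that block_in_space]])
  have val: "separable b \<Psi> (lift v) = ereal (S x + \<psi> i v - \<psi> i (block b i x))"
    if "v \<in> block_space b i" "\<Psi> i v \<noteq> \<infinity>" for v
  proof -
    have "separable b \<Psi> (lift v) = ereal (S (lift v))"
      unfolding S_def using fin [OF that(1)] that(2)
      by (intro separable_real) (auto simp: separable_finite_iff)
    also have "S (lift v) = S x + \<psi> i v - \<psi> i (block b i x)"
      using that by (simp add: S_def lift_def sum_shift [OF block_space_diff [OF that(1) block_in_space]])
    finally show ?thesis .
  qed
  have "lift w = (1 - t) *\<^sub>R lift u + t *\<^sub>R lift v"
    by (simp add: lift_def w_def algebra_simps)
  then have le: "separable b \<Psi> (lift w)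
      \<le> ereal (1 - t) * separable b \<Psi> (lift u) + ereal t * separable b \<Psi> (lift v)"
    using convex_\<Psi> t unfolding ereal_convex_def by auto
  also have "\<dots> = ereal ((1 - t) * (S x + \<psi> i u - \<psi> i (block b i x))
      + t * (S x + \<psi> i v - \<psi> i (block b i x)))"
    by (simp add: val u v)
  finally have le: "separable b \<Psi> (lift w) \<le> \<dots>" .
  then have "separable b \<Psi> (lift w) \<noteq> \<infinity>" by auto
  then show fw: "\<Psi> i w \<noteq> \<infinity>" using fin [OF w] by blast
  from le show "\<psi> i w \<le> (1 - t) * \<psi> i u + t * \<psi> i v"
    by (simp add: val [OF w fw]) (simp add: algebra_simps)
qed

section \<open>The block subproblem\<close>

lemma block_direction:
  assumes d: "is_block_direction b grad \<Psi> \<theta> x i d" and x: "F x \<noteq> \<infinity>"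
  shows block_direction_space: "d \<in> block_space b i"
    and block_direction_finite: "\<Psi> i (block b i x + d) \<noteq> \<infinity>"
    and block_direction_le: "\<And>s. s \<in> block_space b i \<Longrightarrow> \<Psi> i (block b i x + s) \<noteq> \<infinity> \<Longrightarrow>
      grad x \<bullet> d + \<theta> / 2 * (norm d)\<^sup>2 + \<psi> i (block b i x + d)
        \<le> grad x \<bullet> s + \<theta> / 2 * (norm s)\<^sup>2 + \<psi> i (block b i x + s)"
proof -
  have sp: "d \<in> block_space b i"
    and min: "\<And>s. s \<in> block_space b i \<Longrightarrow>
      ereal (block b i (grad x) \<bullet> d + \<theta> / 2 * (norm d)\<^sup>2) + \<Psi> i (block b i x + d)
      \<le> ereal (block b i (grad x) \<bullet> s + \<theta> / 2 * (norm s)\<^sup>2) + \<Psi> i (block b i x + s)"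
    using d by (auto simp: is_block_direction_def is_arg_min_linorder)
  show "d \<in> block_space b i" by (fact sp)
  have "\<Psi> i (block b i x) \<noteq> \<infinity>" using x by (simp add: F_finite_iff)
  with min [of 0] show fin: "\<Psi> i (block b i x + d) \<noteq> \<infinity>" by auto
  fix s assume s: "s \<in> block_space b i" "\<Psi> i (block b i x + s) \<noteq> \<infinity>"
  show "grad x \<bullet> d + \<theta> / 2 * (norm d)\<^sup>2 + \<psi> i (block b i x + d)
        \<le> grad x \<bullet> s + \<theta> / 2 * (norm s)\<^sup>2 + \<psi> i (block b i x + s)"
    using min [OF s(1)] \<Psi>_real [OF block_space_add [OF block_in_space s(1)] s(2)]
      \<Psi>_real [OF block_space_add [OF block_in_space sp] fin]
    by (metis inner_block ereal_less_eq(3) plus_ereal.simps(1) s(1) sp)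
qed

text \<open>
  First-order optimality without subgradients: moving from \<open>d\<close> a fraction \<open>t\<close> of the way towards \<open>s\<close>
  does not decrease the objective, and by convexity the change is at most \<open>t\<close> times the
  right-hand side plus a term of order \<open>t\<^sup>2\<close>. Dividing by \<open>t\<close> and letting \<open>t\<close> tend to \<open>0\<close> gives
  the claim.
\<close>

lemma block_direction_variational:
  assumes d: "is_block_direction b grad \<Psi> \<theta> x i d" and x: "F x \<noteq> \<infinity>"
    and s: "s \<in> block_space b i" "\<Psi> i (block b i x + s) \<noteq> \<infinity>"
  shows "0 \<le> (grad x + \<theta> *\<^sub>R d) \<bullet> (s - d) + \<psi> i (block b i x + s) - \<psi> i (block b i x + d)"
    (is "0 \<le> ?A")
proof -
  note dsp = block_direction_space [OF d x] and dfin = block_direction_finite [OF d x]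
  define B where "B = \<theta> / 2 * (norm (s - d))\<^sup>2"
  have pos: "0 \<le> ?A + t * B" if t: "0 < t" "t < 1" for t
  proof -
    define r where "r = d + t *\<^sub>R (s - d)"
    have r: "block b i x + r = (1 - t) *\<^sub>R (block b i x + d) + t *\<^sub>R (block b i x + s)"
      by (simp add: r_def algebra_simps)
    have rsp: "r \<in> block_space b i"
      unfolding r_def by (intro block_space_add block_space_scaleR block_space_diff dsp s)
    have conv: "\<Psi> i (block b i x + r) \<noteq> \<infinity>"
      "\<psi> i (block b i x + r) \<le> (1 - t) * \<psi> i (block b i x + d) + t * \<psi> i (block b i x + s)"
      unfolding r by (intro \<Psi>_block_convex [OF x] block_space_add block_in_space dsp dfin s t)+
    have norm_r: "(norm r)\<^sup>2 = (norm d)\<^sup>2 + 2 * t * (d \<bullet> (s - d)) + t\<^sup>2 * (norm (s - d))\<^sup>2"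
      unfolding r_def
      by (simp only: power2_norm_eq_inner inner_add_left inner_add_right inner_scaleR_left
          inner_scaleR_right) (simp add: inner_commute power2_eq_square algebra_simps)
    have grad_r: "grad x \<bullet> r = grad x \<bullet> d + t * (grad x \<bullet> (s - d))"
      by (simp add: r_def inner_add_right)
    have "grad x \<bullet> r + \<theta> / 2 * (norm r)\<^sup>2 = grad x \<bullet> d + \<theta> / 2 * (norm d)\<^sup>2
        + t * ((grad x + \<theta> *\<^sub>R d) \<bullet> (s - d)) + t * (t * B)"
      unfolding norm_r grad_r
      by (simp add: B_def inner_add_left power2_eq_square field_simps)
    with block_direction_le [OF d x rsp conv(1)] conv(2) have "0 \<le> t * (?A + t * B)"
      by (simp add: algebra_simps)
    then show ?thesis using t by (simp add: zero_le_mult_iff)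
  qed
  have "((\<lambda>t. ?A + t * B) \<longlongrightarrow> ?A + 0 * B) (at_right 0)"
    by (intro tendsto_intros)
  moreover have "\<forall>\<^sub>F t in at_right 0. 0 \<le> ?A + t * B"
    by (rule eventually_mono [OF eventually_at_right_real [of 0 1]]) (auto intro: pos)
  ultimately show ?thesis
    using tendsto_lowerbound [of "\<lambda>t. ?A + t * B" "?A + 0 * B" "at_right 0" 0] by simp
qed

text \<open>
  Testing the variational inequality of \<open>d\<close> with \<open>g\<close>, that of \<open>g\<close> with \<open>d\<close>, and adding the two
  eliminates the gradient and \<open>\<Psi>\<close>. With Cauchy-Schwarz what remains is
  \<open>(\<parallel>g\<parallel> - \<parallel>d\<parallel>) * (\<parallel>g\<parallel> - \<theta> * \<parallel>d\<parallel>) \<le> 0\<close>, so \<open>\<parallel>g\<parallel>\<close> lies between \<open>\<parallel>d\<parallel>\<close> and \<open>\<theta> * \<parallel>d\<parallel>\<close>.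
\<close>

lemma block_direction_norm_le:
  assumes d: "is_block_direction b grad \<Psi> \<theta> x i d"
    and g: "is_block_direction b grad \<Psi> 1 x i g" and x: "F x \<noteq> \<infinity>" and \<theta>: "0 \<le> \<theta>"
  shows "norm g \<le> max 1 \<theta> * norm d"
proof (rule ccontr)
  assume "\<not> ?thesis"
  then have big: "max 1 \<theta> * norm d < norm g" by simp
  have "1 * norm d \<le> max 1 \<theta> * norm d" "\<theta> * norm d \<le> max 1 \<theta> * norm d"
    by (intro mult_right_mono; simp)+
  with big have "0 < (norm g - norm d) * (norm g - \<theta> * norm d)"
    by (intro mult_pos_pos) auto
  moreover have "0 \<le> (\<theta> *\<^sub>R d - g) \<bullet> (g - d)"
    using block_direction_variational [OF d x block_direction_space [OF g x]
        block_direction_finite [OF g x]]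
      block_direction_variational [OF g x block_direction_space [OF d x]
        block_direction_finite [OF d x]]
    by (simp add: inner_add_left inner_diff_left inner_diff_right inner_commute algebra_simps)
  then have "0 \<le> (1 + \<theta>) * (g \<bullet> d) - \<theta> * (norm d)\<^sup>2 - (norm g)\<^sup>2"
    by (simp add: inner_diff_left inner_diff_right inner_commute power2_norm_eq_inner
        algebra_simps)
  moreover have "(1 + \<theta>) * (g \<bullet> d) \<le> (1 + \<theta>) * (norm g * norm d)"
    using \<theta> by (intro mult_left_mono norm_cauchy_schwarz) simp
  ultimately show False
    by (simp add: algebra_simps power2_eq_square)
qed

text \<open>
  Replacing block \<open>i\<close> of \<open>g\<close> by a competitor \<open>s\<close> changes the full objective exactly as it changes the
  objective of the i-th subproblem, because every term of the full objective splits over the blocks.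
\<close>

lemma prox_direction_block:
  assumes g: "is_prox_direction grad (separable b \<Psi>) x g" and x: "F x \<noteq> \<infinity>"
  shows "is_block_direction b grad \<Psi> 1 x i (block b i g)"
proof -
  define u where "u = block b i g"
  have min: "ereal (grad x \<bullet> g + 1 / 2 * (norm g)\<^sup>2) + separable b \<Psi> (x + g)
      \<le> ereal (grad x \<bullet> d + 1 / 2 * (norm d)\<^sup>2) + separable b \<Psi> (x + d)" for d
    using g by (auto simp: is_prox_direction_def is_arg_min_linorder)
  have "separable b \<Psi> x \<noteq> \<infinity>" using x by (simp add: F_finite_iff separable_finite_iff)
  with min [of 0] have fin: "separable b \<Psi> (x + g) \<noteq> \<infinity>" by auto
  have usp: "u \<in> block_space b i" by (simp add: u_def)
  have "ereal (block b i (grad x) \<bullet> u + 1 / 2 * (norm u)\<^sup>2) + \<Psi> i (block b i x + u)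
      \<le> ereal (block b i (grad x) \<bullet> s + 1 / 2 * (norm s)\<^sup>2) + \<Psi> i (block b i x + s)"
    if s: "s \<in> block_space b i" for s
  proof (cases "\<Psi> i (block b i x + s) = \<infinity>")
    case False
    define e where "e = s - u"
    have e: "e \<in> block_space b i" using s usp by (simp add: e_def block_space_diff)
    have xs: "block b i (x + g) + e = block b i x + s"
      by (simp add: e_def u_def block_add)
    have Fg: "F (x + g) \<noteq> \<infinity>" using fin by (simp add: F_finite_iff separable_finite_iff)
    have Fe: "F (x + g + e) \<noteq> \<infinity>"
      using F_shift_finite [OF Fg e] False xs by simp
    have u_fin: "\<Psi> i (block b i x + u) \<noteq> \<infinity>"
      using Fg by (simp add: F_finite_iff u_def flip: block_add)
    have "ereal (grad x \<bullet> g + 1 / 2 * (norm g)\<^sup>2) + separable b \<Psi> (x + g)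
      \<le> ereal (grad x \<bullet> (g + e) + 1 / 2 * (norm (g + e))\<^sup>2) + separable b \<Psi> (x + g + e)"
      using min [of "g + e"] by (simp add: add.assoc)
    then have "grad x \<bullet> g + 1 / 2 * (norm g)\<^sup>2 + (\<Sum>j\<in>UNIV. \<psi> j (block b j (x + g)))
      \<le> grad x \<bullet> (g + e) + 1 / 2 * (norm (g + e))\<^sup>2 + (\<Sum>j\<in>UNIV. \<psi> j (block b j (x + g + e)))"
      using Fg Fe by (simp add: separable_real F_finite_iff)
    then have le: "0 \<le> grad x \<bullet> e + ((norm (g + e))\<^sup>2 - (norm g)\<^sup>2) / 2
        + \<psi> i (block b i x + s) - \<psi> i (block b i x + u)"
      unfolding sum_shift [OF e] xs by (simp add: inner_add_right u_def block_add field_simps)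
    have gu: "g \<bullet> v = u \<bullet> v" if "v \<in> block_space b i" for v
      using inner_block [OF that, of g] by (simp add: u_def)
    have "(norm (g + e))\<^sup>2 - (norm g)\<^sup>2 = 2 * (g \<bullet> e) + e \<bullet> e"
      by (simp add: power2_norm_eq_inner inner_add_left inner_add_right inner_commute)
    also have "\<dots> = (norm s)\<^sup>2 - (norm u)\<^sup>2"
      unfolding gu [OF e] by (simp add: e_def power2_norm_eq_inner inner_diff_left
          inner_diff_right inner_commute)
    finally have norms: "(norm (g + e))\<^sup>2 - (norm g)\<^sup>2 = (norm s)\<^sup>2 - (norm u)\<^sup>2" .
    have "block b i (grad x) \<bullet> u + 1 / 2 * (norm u)\<^sup>2 + \<psi> i (block b i x + u)
      \<le> block b i (grad x) \<bullet> s + 1 / 2 * (norm s)\<^sup>2 + \<psi> i (block b i x + s)"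
      using le unfolding norms inner_block [OF s] inner_block [OF usp]
      by (simp add: e_def inner_diff_right field_simps)
    then show ?thesis
      using \<Psi>_real [OF block_space_add [OF block_in_space s] False]
        \<Psi>_real [OF block_space_add [OF block_in_space usp] u_fin]
      by (metis ereal_less_eq(3) plus_ereal.simps(1))
  qed auto
  then show ?thesis
    unfolding is_block_direction_def is_arg_min_linorder using usp by (auto simp: u_def)
qed

section \<open>Acceptance of trial directions\<close>

lemma F_block_le:
  assumes x: "F x \<noteq> \<infinity>" and d: "d \<in> block_space b i" "\<Psi> i (block b i x + d) \<noteq> \<infinity>"
  shows "Fr (x + d) \<le> Fr x + grad x \<bullet> d + L i / 2 * (norm d)\<^sup>2
           + \<psi> i (block b i x + d) - \<psi> i (block b i x)"
  using block_descent [OF d(1), of x] Fr_eq [OF x] Fr_eq [OF F_shift_finite [OF x d]]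
    sum_shift [OF d(1), of x] by simp

lemma sufficient_decrease_iff:
  assumes x: "F x \<noteq> \<infinity>"
  shows "sufficient_decrease F \<sigma> x d
    \<longleftrightarrow> F (x + d) \<noteq> \<infinity> \<and> Fr (x + d) \<le> Fr x - \<sigma> / 2 * (norm d)\<^sup>2"
proof (cases "F (x + d) = \<infinity>")
  case True
  then show ?thesis using F_real [OF x] by (simp add: sufficient_decrease_def)
next
  case False
  then show ?thesis using F_real [OF x] F_real [OF False] by (simp add: sufficient_decrease_def)
qed

text \<open>
  Comparing \<open>d\<close> with \<open>0\<close> bounds the linear term and the change of \<open>\<Psi>\<close> by \<open>- \<theta> / 2 * \<parallel>d\<parallel>\<^sup>2\<close>;
  the descent lemma costs \<open>L i / 2 * \<parallel>d\<parallel>\<^sup>2\<close>, which leaves at least \<open>\<sigma> / 2 * \<parallel>d\<parallel>\<^sup>2\<close>.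
\<close>

lemma trial_accepted:
  assumes d: "is_block_direction b grad \<Psi> \<theta> x i d" and x: "F x \<noteq> \<infinity>"
    and \<theta>: "L i + \<sigma> \<le> \<theta>"
  shows "sufficient_decrease F \<sigma> x d"
proof -
  note dsp = block_direction_space [OF d x] and dfin = block_direction_finite [OF d x]
  have "grad x \<bullet> d + \<theta> / 2 * (norm d)\<^sup>2 + \<psi> i (block b i x + d) \<le> \<psi> i (block b i x)"
    using block_direction_le [OF d x, of 0] x by (simp add: F_finite_iff)
  moreover have "(L i + \<sigma>) * (norm d)\<^sup>2 \<le> \<theta> * (norm d)\<^sup>2"
    using \<theta> by (rule mult_right_mono) simp
  ultimately have "Fr (x + d) \<le> Fr x - \<sigma> / 2 * (norm d)\<^sup>2"
    using F_block_le [OF x dsp dfin] by (simp add: field_simps)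
  then show ?thesis
    using F_shift_finite [OF x dsp dfin] x by (simp add: sufficient_decrease_iff)
qed

text \<open>
  The last rejected trial has \<open>\<theta> < L i + \<sigma>\<close>, and the accepted one is larger by the factor \<open>\<eta>\<close>.
\<close>

lemma rnbpg_stepE:
  assumes step: "rnbpg_step b f grad \<Psi> \<eta> \<sigma> \<theta>lo \<theta>hi x i x'" and x: "F x \<noteq> \<infinity>"
    and \<eta>: "1 < \<eta>" and lo: "0 < \<theta>lo"
  obtains \<theta> d where "\<theta>lo \<le> \<theta>" "\<theta> \<le> max \<theta>hi (\<eta> * (L i + \<sigma>))"
    "is_block_direction b grad \<Psi> \<theta> x i d" "sufficient_decrease F \<sigma> x d" "x' = x + d"
proof -
  from step obtain \<theta>\<^sub>0 J d where \<theta>\<^sub>0: "\<theta>lo \<le> \<theta>\<^sub>0" "\<theta>\<^sub>0 \<le> \<theta>hi"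
    and dir: "\<And>j. j \<le> J \<Longrightarrow> is_block_direction b grad \<Psi> (\<theta>\<^sub>0 * \<eta> ^ j) x i (d j)"
    and rejected: "\<And>j. j < J \<Longrightarrow> \<not> sufficient_decrease F \<sigma> x (d j)"
    and acc: "sufficient_decrease F \<sigma> x (d J)" "x' = x + d J"
    unfolding rnbpg_step_def by (elim bexE exE conjE) (rule that; auto)
  have "\<theta>lo * 1 \<le> \<theta>\<^sub>0 * \<eta> ^ J"
    using \<theta>\<^sub>0 lo \<eta> by (intro mult_mono one_le_power) auto
  moreover have "\<theta>\<^sub>0 * \<eta> ^ J \<le> max \<theta>hi (\<eta> * (L i + \<sigma>))"
  proof (cases J)
    case (Suc j)
    then have "\<not> L i + \<sigma> \<le> \<theta>\<^sub>0 * \<eta> ^ j"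
      using trial_accepted [OF dir [of j] x] rejected [of j] by auto
    then have "\<eta> * (\<theta>\<^sub>0 * \<eta> ^ j) \<le> \<eta> * (L i + \<sigma>)"
      using \<eta> by (intro mult_left_mono) auto
    then show ?thesis by (simp add: Suc mult.left_commute)
  qed (use \<theta>\<^sub>0 in simp)
  ultimately show ?thesis using that [OF _ _ dir [of J] acc] by simp
qed

section \<open>Total decrease over all blocks\<close>

lemma block_model_sum_le:
  assumes x: "F x \<noteq> \<infinity>" and y: "F y \<noteq> \<infinity>"
    and d: "\<And>i. is_block_direction b grad \<Psi> (\<theta> i) x i (d i)" and \<theta>: "\<And>i. \<theta> i \<le> c"
  shows "(\<Sum>i\<in>UNIV. grad x \<bullet> d i + \<theta> i / 2 * (norm (d i))\<^sup>2
            + \<psi> i (block b i x + d i) - \<psi> i (block b i x))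
         \<le> Fr y - Fr x + c / 2 * (dist x y)\<^sup>2" (is "?S \<le> _")
proof -
  let ?s = "\<lambda>i. block b i (y - x)"
  have "?S \<le> (\<Sum>i\<in>UNIV. grad x \<bullet> ?s i + c / 2 * (norm (?s i))\<^sup>2
            + \<psi> i (block b i y) - \<psi> i (block b i x))"
  proof (rule sum_mono)
    fix i
    have "grad x \<bullet> d i + \<theta> i / 2 * (norm (d i))\<^sup>2 + \<psi> i (block b i x + d i)
        \<le> grad x \<bullet> ?s i + \<theta> i / 2 * (norm (?s i))\<^sup>2 + \<psi> i (block b i y)"
      using block_direction_le [OF d x block_in_space [of b i "y - x"]] y by (simp add: block_diff F_finite_iff)
    moreover have "\<theta> i / 2 * (norm (?s i))\<^sup>2 \<le> c / 2 * (norm (?s i))\<^sup>2"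
      using \<theta> by (intro mult_right_mono) auto
    ultimately show "grad x \<bullet> d i + \<theta> i / 2 * (norm (d i))\<^sup>2
        + \<psi> i (block b i x + d i) - \<psi> i (block b i x)
        \<le> grad x \<bullet> ?s i + c / 2 * (norm (?s i))\<^sup>2 + \<psi> i (block b i y) - \<psi> i (block b i x)"
      by simp
  qed
  also have "\<dots> = grad x \<bullet> (y - x) + c / 2 * (norm (y - x))\<^sup>2
      + (\<Sum>i\<in>UNIV. \<psi> i (block b i y)) - (\<Sum>i\<in>UNIV. \<psi> i (block b i x))"
    by (simp only: sum.distrib sum_subtractf sum_distrib_left [symmetric] norm_sum_block
        inner_sum_right [symmetric] sum_block)
  also have "\<dots> \<le> Fr y - Fr x + c / 2 * (dist x y)\<^sup>2"
    using convex_gradient_inequality [OF convex_f grad, of x y] Fr_eq [OF x] Fr_eq [OF y]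
    by (simp add: dist_norm norm_minus_commute)
  finally show ?thesis .
qed

lemma minimizer_F:
  assumes x: "F x \<noteq> \<infinity>" and y: "y \<in> minimizers F"
  shows "F y \<noteq> \<infinity>" and "Fr y = real_of_ereal (optimal_value F)"
proof -
  have min: "F y \<le> F z" for z
    using y by (auto simp: minimizers_def is_arg_min_linorder)
  show "F y \<noteq> \<infinity>" using min [of x] x by auto
  have "optimal_value F = F y"
    unfolding optimal_value_def by (rule antisym) (auto intro: INF_lower INF_greatest min)
  then show "Fr y = real_of_ereal (optimal_value F)" by simp
qed

text \<open>
  The distance to the optimal set is an infimum that need not be attained, as that set may fail
  to be closed; the bound for each optimal point is therefore solved for the distance before the
  infimum is taken.
\<close>

lemma block_model_sum_le_infdist:
  assumes x: "F x \<noteq> \<infinity>" and ne: "minimizers F \<noteq> {}" and c: "0 < c"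
    and d: "\<And>i. is_block_direction b grad \<Psi> (\<theta> i) x i (d i)" and \<theta>: "\<And>i. \<theta> i \<le> c"
  shows "(\<Sum>i\<in>UNIV. grad x \<bullet> d i + \<theta> i / 2 * (norm (d i))\<^sup>2
            + \<psi> i (block b i x + d i) - \<psi> i (block b i x))
         \<le> real_of_ereal (optimal_value F) - Fr x + c / 2 * (infdist x (minimizers F))\<^sup>2"
    (is "?S \<le> ?F - _ + _")
proof -
  let ?A = "?S - ?F + Fr x"
  have "sqrt (2 / c * ?A) \<le> infdist x (minimizers F)"
    unfolding infdist_notempty [OF ne]
  proof (rule cINF_greatest [OF ne])
    fix y assume y: "y \<in> minimizers F"
    have "?A \<le> c / 2 * (dist x y)\<^sup>2"
      using block_model_sum_le [OF x minimizer_F(1) [OF x y] d \<theta>] minimizer_F(2) [OF x y]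
      by simp
    then have "2 / c * ?A \<le> (dist x y)\<^sup>2" using c by (simp add: field_simps)
    then show "sqrt (2 / c * ?A) \<le> dist x y" by (intro real_le_lsqrt) auto
  qed
  then have "2 / c * ?A \<le> (infdist x (minimizers F))\<^sup>2" by (rule sqrt_le_D)
  then show ?thesis using c by (simp add: field_simps)
qed

lemma norm_prox_direction_le:
  assumes x: "F x \<noteq> \<infinity>" and g: "is_prox_direction grad (separable b \<Psi>) x g"
    and d: "\<And>i. is_block_direction b grad \<Psi> (\<theta> i) x i (d i)"
    and \<theta>: "\<And>i. 0 \<le> \<theta> i" "\<And>i. \<theta> i \<le> c"
  shows "(norm g)\<^sup>2 \<le> (max 1 c)\<^sup>2 * (\<Sum>i\<in>UNIV. (norm (d i))\<^sup>2)"
proof -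
  have "(norm (block b i g))\<^sup>2 \<le> (max 1 c)\<^sup>2 * (norm (d i))\<^sup>2" for i
  proof -
    have "norm (block b i g) \<le> max 1 (\<theta> i) * norm (d i)"
      by (rule block_direction_norm_le [OF d prox_direction_block [OF g x] x \<theta>(1)])
    also have "\<dots> \<le> max 1 c * norm (d i)"
      using \<theta>(2) [of i] by (intro mult_right_mono) auto
    finally show ?thesis
      using power_mono [of _ _ 2] by (fastforce simp: power_mult_distrib)
  qed
  then have "(\<Sum>i\<in>UNIV. (norm (block b i g))\<^sup>2) \<le> (\<Sum>i\<in>UNIV. (max 1 c)\<^sup>2 * (norm (d i))\<^sup>2)"
    by (rule sum_mono)
  then show ?thesis by (simp add: norm_sum_block sum_distrib_left)
qed

text \<open>
  A bound on the gap \<open>F x - F*\<close> by \<open>D\<close> alone is impossible in general, since at a kink of \<open>F\<close> the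
  gap may be linear in the step; the total decrease must take part in the estimate.
\<close>

lemma sum_block_decrease_ge:
  assumes x: "F x \<noteq> \<infinity>" and ne: "minimizers F \<noteq> {}" and c: "0 < c" and \<tau>: "0 \<le> \<tau>"
    and d: "\<And>i. is_block_direction b grad \<Psi> (\<theta> i) x i (d i)"
    and \<theta>: "0 \<le> \<theta>lo" "\<And>i. \<theta>lo \<le> \<theta> i" "\<And>i. \<theta> i \<le> c" and Lmax: "\<And>i. L i \<le> Lmax"
    and g: "is_prox_direction grad (separable b \<Psi>) x g"
    and eb: "infdist x (minimizers F) \<le> \<tau> * norm g"
  shows "Fr x - real_of_ereal (optimal_value F)
      - (c * \<tau>\<^sup>2 * (max 1 c)\<^sup>2 / 2 + (Lmax - \<theta>lo) / 2) * (\<Sum>i\<in>UNIV. (norm (d i))\<^sup>2)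
      \<le> (\<Sum>i\<in>UNIV. Fr x - Fr (x + d i))"
proof -
  let ?Fs = "real_of_ereal (optimal_value F)"
  let ?D = "\<Sum>i\<in>UNIV. (norm (d i))\<^sup>2"
  let ?m = "\<lambda>i. grad x \<bullet> d i + \<theta> i / 2 * (norm (d i))\<^sup>2
            + \<psi> i (block b i x + d i) - \<psi> i (block b i x)"
  have "- ?m i - (Lmax - \<theta>lo) / 2 * (norm (d i))\<^sup>2 \<le> Fr x - Fr (x + d i)" for i
  proof -
    have "L i / 2 * (norm (d i))\<^sup>2 - \<theta> i / 2 * (norm (d i))\<^sup>2
        \<le> (Lmax - \<theta>lo) / 2 * (norm (d i))\<^sup>2"
      unfolding left_diff_distrib [symmetric] using \<theta>(2) [of i] Lmax [of i]
      by (intro mult_right_mono) auto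
    then show ?thesis
      using F_block_le [OF x block_direction_space [OF d x] block_direction_finite [OF d x]]
      by (smt (verit))
  qed
  then have "(\<Sum>i\<in>UNIV. - ?m i - (Lmax - \<theta>lo) / 2 * (norm (d i))\<^sup>2)
      \<le> (\<Sum>i\<in>UNIV. Fr x - Fr (x + d i))"
    by (rule sum_mono)
  then have "- (\<Sum>i\<in>UNIV. ?m i) - (Lmax - \<theta>lo) / 2 * ?D \<le> (\<Sum>i\<in>UNIV. Fr x - Fr (x + d i))"
    by (simp only: sum_subtractf sum_negf sum_distrib_left)
  moreover have "(infdist x (minimizers F))\<^sup>2 \<le> \<tau>\<^sup>2 * ((max 1 c)\<^sup>2 * ?D)"
  proof -
    have "(infdist x (minimizers F))\<^sup>2 \<le> \<tau>\<^sup>2 * (norm g)\<^sup>2"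
      using power_mono [OF eb, of 2] by (simp add: infdist_nonneg power_mult_distrib)
    also have "\<dots> \<le> \<tau>\<^sup>2 * ((max 1 c)\<^sup>2 * ?D)"
      using order_trans [OF \<theta>(1) \<theta>(2)] \<theta>(3)
      by (intro mult_left_mono norm_prox_direction_le [OF x g d]) auto
    finally show ?thesis .
  qed
  then have "c / 2 * (infdist x (minimizers F))\<^sup>2 \<le> c / 2 * (\<tau>\<^sup>2 * ((max 1 c)\<^sup>2 * ?D))"
    using c by (intro mult_left_mono) auto
  ultimately show ?thesis
    using block_model_sum_le_infdist [OF x ne c d \<theta>(3)]
    by (simp add: distrib_right mult.assoc)
qed

end

section \<open>The contraction constant\<close>

text \<open>
  The bracket in the definition of \<open>varpi\<close> grows with \<open>1 / \<theta>lo\<close>. At the smallest possible value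
  \<open>1 / \<theta>lo = 1 / c\<close> its radicand is the square of \<open>1 - 1 / c\<close>, and \<open>c / 2\<close> times the bracket is
  \<open>(c + 1 + \<bar>c - 1\<bar>) / 2 = max 1 c\<close>.
\<close>

lemma rnbpg_varpi_ge:
  assumes lo: "0 < \<theta>lo" "\<theta>lo \<le> c" and Lf: "0 \<le> Lf"
  shows "c * \<tau>\<^sup>2 * (max 1 c)\<^sup>2 / 2 + (Lmax - \<theta>lo) / 2 \<le> rnbpg_varpi c Lf Lmax \<tau> \<theta>lo"
proof -
  define B where "B = 1 + 1 / \<theta>lo + sqrt (1 - 2 / c + 1 / \<theta>lo\<^sup>2)"
  have c: "0 < c" using lo by simp
  have inv: "1 / c \<le> 1 / \<theta>lo" using lo by (intro divide_left_mono) auto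
  then have "(1 / c)\<^sup>2 \<le> (1 / \<theta>lo)\<^sup>2" using c by (intro power_mono) auto
  then have "(1 - 1 / c)\<^sup>2 \<le> 1 - 2 / c + 1 / \<theta>lo\<^sup>2"
    by (simp add: power2_eq_square algebra_simps)
  then have "sqrt ((1 - 1 / c)\<^sup>2) \<le> sqrt (1 - 2 / c + 1 / \<theta>lo\<^sup>2)"
    by (rule real_sqrt_le_mono)
  with inv have "1 + 1 / c + \<bar>1 - 1 / c\<bar> \<le> B" by (simp add: B_def)
  then have "c * (1 + 1 / c + \<bar>1 - 1 / c\<bar>) \<le> c * B" using c by (intro mult_left_mono) auto
  moreover have "c * \<bar>1 - 1 / c\<bar> = \<bar>c - 1\<bar>"
    using c by (simp add: abs_if field_simps)
  ultimately have "2 * max 1 c \<le> c * B"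
    using c by (simp add: distrib_left)
  then have "(2 * max 1 c)\<^sup>2 \<le> (c * B)\<^sup>2" by (intro power_mono) auto
  then have "4 * (max 1 c)\<^sup>2 \<le> c\<^sup>2 * B\<^sup>2" by (simp add: power_mult_distrib)
  then have "c * \<tau>\<^sup>2 / 8 * (4 * (max 1 c)\<^sup>2) \<le> c * \<tau>\<^sup>2 / 8 * (c\<^sup>2 * B\<^sup>2)"
    using c by (intro mult_left_mono) auto
  also have "\<dots> \<le> (c + Lf) * \<tau>\<^sup>2 / 8 * (c\<^sup>2 * B\<^sup>2)"
    using Lf by (intro mult_right_mono divide_right_mono) auto
  finally show ?thesis by (simp add: rnbpg_varpi_def B_def)
qed

text \<open>
  Here \<open>r\<close> is the gap before the step, and \<open>a i\<close> the decrease obtained when block \<open>i\<close> is drawn. Adding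
  \<open>\<sigma>\<close> times the bound \<open>total\<close> and \<open>2 * w\<close> times the summed bounds \<open>a\<close> cancels the sum of \<open>D\<close>.
\<close>

lemma weighted_sum_le_contraction:
  fixes a p D :: "'n::finite \<Rightarrow> real"
  assumes a: "\<And>i. \<sigma> / 2 * D i \<le> a i" and D: "\<And>i. 0 \<le> D i" and \<sigma>: "0 < \<sigma>"
    and p: "\<And>i. pmin \<le> p i" "0 \<le> pmin" and w: "0 \<le> w"
    and total: "r - w * (\<Sum>i\<in>UNIV. D i) \<le> (\<Sum>i\<in>UNIV. a i)"
  shows "r - (\<Sum>i\<in>UNIV. p i * a i) \<le> (2 * w + (1 - pmin) * \<sigma>) / (2 * w + \<sigma>) * r"
proof -
  let ?A = "\<Sum>i\<in>UNIV. a i"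
  have a0: "0 \<le> a i" for i
    using a [of i] D [of i] \<sigma> by (smt (verit) mult_nonneg_nonneg divide_nonneg_pos)
  have "\<sigma> / 2 * (\<Sum>i\<in>UNIV. D i) \<le> ?A"
    unfolding sum_distrib_left by (intro sum_mono a)
  then have "w * (\<sigma> * (\<Sum>i\<in>UNIV. D i)) \<le> w * (2 * ?A)"
    using w by (intro mult_left_mono) auto
  moreover have "\<sigma> * (r - w * (\<Sum>i\<in>UNIV. D i)) \<le> \<sigma> * ?A"
    using total \<sigma> by (intro mult_left_mono) auto
  ultimately have "\<sigma> * r \<le> (2 * w + \<sigma>) * ?A" by (simp add: algebra_simps)
  then have "\<sigma> / (2 * w + \<sigma>) * r \<le> ?A" using w \<sigma> by (simp add: field_simps)
  then have "pmin * (\<sigma> / (2 * w + \<sigma>) * r) \<le> pmin * ?A" using p(2) by (rule mult_left_mono)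
  also have "\<dots> \<le> (\<Sum>i\<in>UNIV. p i * a i)"
    unfolding sum_distrib_left by (intro sum_mono mult_right_mono p a0)
  finally have "r - (\<Sum>i\<in>UNIV. p i * a i) \<le> r - pmin * (\<sigma> / (2 * w + \<sigma>) * r)" by simp
  also have "\<dots> = (2 * w + (1 - pmin) * \<sigma>) / (2 * w + \<sigma>) * r"
    using w \<sigma> by (simp add: field_simps)
  finally show ?thesis .
qed

section \<open>Expectations over the history of draws\<close>

lemma (in prob_space) prob_history:
  fixes I :: "nat \<Rightarrow> 'a \<Rightarrow> 'n"
  assumes indep: "indep_vars (\<lambda>_. count_space UNIV) I UNIV"
    and law: "\<And>t i. prob {w \<in> space M. I t w = i} = p i"
  shows "prob {w \<in> space M. map (\<lambda>t. I t w) [0..<length h] = h} = prod_list (map p h)"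
proof (cases "h = []")
  case True
  then show ?thesis by (simp add: prob_space)
next
  case False
  have "{w \<in> space M. map (\<lambda>t. I t w) [0..<length h] = h}
      = (\<Inter>t\<in>{..<length h}. I t -` {h ! t} \<inter> space M)"
    (is "?L = ?R")
  proof (rule set_eqI)
    fix w
    have "map (\<lambda>t. I t w) [0..<length h] = h \<longleftrightarrow> (\<forall>t<length h. I t w = h ! t)"
      by (subst list_eq_iff_nth_eq) simp
    then show "w \<in> ?L \<longleftrightarrow> w \<in> ?R" using False by auto
  qed
  also have "prob \<dots> = (\<Prod>t\<in>{..<length h}. prob (I t -` {h ! t} \<inter> space M))"
    by (rule indep_varsD [OF indep]) (use False in auto)
  also have "\<dots> = (\<Prod>t\<in>{..<length h}. p (h ! t))"
  proof (rule prod.cong)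
    fix t
    have "I t -` {h ! t} \<inter> space M = {w \<in> space M. I t w = h ! t}" by auto
    then show "prob (I t -` {h ! t} \<inter> space M) = p (h ! t)" by (simp add: law)
  qed simp
  also have "\<dots> = prod_list (map p h)"
    by (simp add: prod.list_conv_set_nth atLeast0LessThan)
  finally show ?thesis .
qed

lemma (in prob_space) expectation_history:
  fixes I :: "nat \<Rightarrow> 'a \<Rightarrow> 'n::finite" and G :: "'n list \<Rightarrow> real"
  assumes indep: "indep_vars (\<lambda>_. count_space UNIV) I UNIV"
    and law: "\<And>t i. prob {w \<in> space M. I t w = i} = p i"
  shows "expectation (\<lambda>w. G (map (\<lambda>t. I t w) [0..<k]))
       = (\<Sum>h | length h = k. prod_list (map p h) * G h)"
proof -
  let ?S = "{h :: 'n list. length h = k}"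
  let ?E = "\<lambda>h. {w \<in> space M. map (\<lambda>t. I t w) [0..<k] = h}"
  have fin: "finite ?S"
    using finite_lists_length_eq [of "UNIV :: 'n set" k] by simp
  have [measurable]: "I t \<in> measurable M (count_space UNIV)" for t
    using indep by (simp add: indep_vars_def)
  have sets: "?E h \<in> events" if "length h = k" for h
  proof -
    have "?E h = {w \<in> space M. \<forall>t\<in>{..<k}. I t w = h ! t}"
      using that by (auto simp: list_eq_iff_nth_eq)
    also have "\<dots> \<in> events" by measurable
    finally show ?thesis .
  qed
  have "G (map (\<lambda>t. I t w) [0..<k]) = (\<Sum>h\<in>?S. G h * indicator (?E h) w)"
    if "w \<in> space M" for w
  proof -
    have "(\<Sum>h\<in>?S. G h * indicator (?E h) w)
        = (\<Sum>h\<in>?S. if h = map (\<lambda>t. I t w) [0..<k] then G h else 0)"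
      using that by (intro sum.cong) (auto simp: indicator_def)
    then show ?thesis using fin by simp
  qed
  then have "expectation (\<lambda>w. G (map (\<lambda>t. I t w) [0..<k]))
      = expectation (\<lambda>w. \<Sum>h\<in>?S. G h * indicator (?E h) w)"
    by (intro Bochner_Integration.integral_cong) auto
  also have "\<dots> = (\<Sum>h\<in>?S. G h * prob (?E h))"
    using sets by (subst Bochner_Integration.integral_sum) (auto simp: emeasure_eq_measure)
  also have "\<dots> = (\<Sum>h\<in>?S. prod_list (map p h) * G h)"
    using prob_history [OF indep law] by (intro sum.cong) auto
  finally show ?thesis .
qed

lemma sum_lists_Suc:
  fixes g :: "'n::finite list \<Rightarrow> real"
  shows "(\<Sum>h | length h = Suc k. g h) = (\<Sum>h | length h = k. \<Sum>i\<in>UNIV. g (h @ [i]))"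
proof -
  have "(\<Sum>h | length h = k. \<Sum>i\<in>UNIV. g (h @ [i]))
      = (\<Sum>(h, i) \<in> {h. length h = k} \<times> UNIV. g (h @ [i]))"
    by (rule sum.cartesian_product)
  also have "\<dots> = (\<Sum>h | length h = Suc k. g h)"
    by (rule sum.reindex_bij_witness [where i = "\<lambda>h. (butlast h, last h)" and j = "\<lambda>(h, i). h @ [i]"])
      (auto simp: length_Suc_conv_rev)
  finally show ?thesis by simp
qed

lemma sum_prod_list_eq_1:
  fixes p :: "'n::finite \<Rightarrow> real"
  assumes "(\<Sum>i\<in>UNIV. p i) = 1"
  shows "(\<Sum>h | length h = k. prod_list (map p h)) = 1"
  by (induction k) (simp_all add: sum_lists_Suc sum_distrib_left [symmetric] assms)

lemma weighted_sum_geometric_decay: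
  fixes p :: "'n::finite \<Rightarrow> real" and G :: "'n list \<Rightarrow> real"
  assumes p: "\<And>i. 0 \<le> p i" and q: "0 \<le> q"
    and decay: "\<And>h. (\<Sum>i\<in>UNIV. p i * G (h @ [i])) \<le> q * G h"
  shows "(\<Sum>h | length h = k. prod_list (map p h) * G h) \<le> q ^ k * G []"
proof (induction k)
  case (Suc k)
  have "(\<Sum>h | length h = Suc k. prod_list (map p h) * G h)
      = (\<Sum>h | length h = k. prod_list (map p h) * (\<Sum>i\<in>UNIV. p i * G (h @ [i])))"
    by (simp add: sum_lists_Suc sum_distrib_left mult.assoc)
  also have "\<dots> \<le> (\<Sum>h | length h = k. prod_list (map p h) * (q * G h))"
    by (intro sum_mono mult_left_mono decay prod_list_nonneg) (auto simp: p)
  also have "\<dots> = q * (\<Sum>h | length h = k. prod_list (map p h) * G h)"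
    by (simp add: sum_distrib_left mult.left_commute)
  also have "\<dots> \<le> q * (q ^ k * G [])" by (intro mult_left_mono Suc.IH q)
  finally show ?case by simp
qed simp

section \<open>Linear convergence in expectation\<close>

theorem theorem3p4:
  fixes b :: "'m::finite \<Rightarrow> 'n::finite"
    and f :: "real ^ 'm \<Rightarrow> real"
    and grad :: "real ^ 'm \<Rightarrow> real ^ 'm"
    and \<Psi> :: "'n \<Rightarrow> real ^ 'm \<Rightarrow> ereal"
    and F :: "real ^ 'm \<Rightarrow> ereal"
    and L p :: "'n \<Rightarrow> real"
    and \<eta> \<sigma> \<theta>lo \<theta>hi \<tau> Lf Lmax pmin c varpi Fstar :: real
    and x :: "'n list \<Rightarrow> real ^ 'm"
    and ghat :: "'n list \<Rightarrow> real ^ 'm"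
    and M :: "'w measure"
    and I :: "nat \<Rightarrow> 'w \<Rightarrow> 'n"
    and k :: nat
  assumes grad: "\<And>z. GDERIV f z :> grad z"
    and \<Psi>_proper: "\<And>i v. v \<in> block_space b i \<Longrightarrow> \<Psi> i v \<noteq> -\<infinity>"
    and L_pos: "\<And>i. 0 < L i"
    and lipschitz: "\<And>z i h. h \<in> block_space b i \<Longrightarrow>
          norm (block b i (grad (z + h)) - block b i (grad z)) \<le> L i * norm h"
    and F_eq: "F = composite f (separable b \<Psi>)"
    and solvable: "minimizers F \<noteq> {}"
    and f_convex: "convex_on UNIV f"
    and \<Psi>_convex: "ereal_convex (separable b \<Psi>)"
    and params: "1 < \<eta>" "0 < \<sigma>" "0 < \<theta>lo" "\<theta>lo \<le> \<theta>hi"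
    and p_range: "\<And>i. 0 < p i \<and> p i < 1"
    and p_sum: "(\<Sum>i\<in>UNIV. p i) = 1"
    and iterates: "rnbpg_iterates b f grad \<Psi> \<eta> \<sigma> \<theta>lo \<theta>hi x"
    and prob: "prob_space M"
    and indep: "prob_space.indep_vars M (\<lambda>_. count_space UNIV) I UNIV"
    and law: "\<And>t i. measure M {w \<in> space M. I t w = i} = p i"
    and ghat: "\<And>h. is_prox_direction grad (separable b \<Psi>) (x h) (ghat h)"
    and tau_pos: "0 < \<tau>"
    and error_bound: "\<And>h. infdist (x h) (minimizers F) \<le> \<tau> * norm (ghat h)"
    and Lf_eq: "Lf = (\<Sum>i\<in>UNIV. L i)"
    and Lmax_eq: "Lmax = Max (range L)"
    and pmin_eq: "pmin = Min (range p)"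
    and c_eq: "c = max \<theta>hi (\<eta> * (Lmax + \<sigma>))"
    and varpi_eq: "varpi = rnbpg_varpi c Lf Lmax \<tau> \<theta>lo"
    and varpi_nonneg: "0 \<le> varpi"
    and Fstar_eq: "Fstar = real_of_ereal (optimal_value F)"
  shows "prob_space.expectation M
           (\<lambda>w. real_of_ereal (F (x (map (\<lambda>t. I t w) [0..<k])))) - Fstar
         \<le> ((2 * varpi + (1 - pmin) * \<sigma>) / (2 * varpi + \<sigma>)) ^ k
            * (real_of_ereal (F (x [])) - Fstar)"
proof -
  interpret prob_space M by (fact prob)
  interpret block_composite b f grad \<Psi> L
    by unfold_locales (fact grad \<Psi>_proper lipschitz f_convex \<Psi>_convex)+
  have Fe: "F = composite f (separable b \<Psi>)" by (fact F_eq)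
  define q where "q = (2 * varpi + (1 - pmin) * \<sigma>) / (2 * varpi + \<sigma>)"
  define G where "G = (\<lambda>h. real_of_ereal (F (x h)) - Fstar)"
  have Lmax: "L i \<le> Lmax" for i by (simp add: Lmax_eq)
  have c: "\<theta>lo \<le> c" "0 < c" using params by (auto simp: c_eq)
  have step: "rnbpg_step b f grad \<Psi> \<eta> \<sigma> \<theta>lo \<theta>hi (x h) i (x (h @ [i]))" for h i
    using iterates by (simp add: rnbpg_iterates_def)
  have \<theta>_le: "\<theta> \<le> c" if "\<theta> \<le> max \<theta>hi (\<eta> * (L i + \<sigma>))" for \<theta> i
  proof -
    have "\<eta> * (L i + \<sigma>) \<le> \<eta> * (Lmax + \<sigma>)"
      using params Lmax by (intro mult_left_mono) auto
    with that show ?thesis by (auto simp: c_eq)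
  qed
  have fin: "F (x h) \<noteq> \<infinity>" for h
  proof (induction h rule: rev_induct)
    case Nil
    then show ?case using iterates by (simp add: rnbpg_iterates_def Fe)
  next
    case (snoc i h)
    have h: "composite f (separable b \<Psi>) (x h) \<noteq> \<infinity>" using snoc by (simp add: Fe)
    show ?case
      using rnbpg_stepE [OF step [of h i] h params(1,3)] sufficient_decrease_iff [OF h]
      by (metis Fe)
  qed
  have pmin: "0 \<le> pmin" "pmin \<le> 1" "\<And>i. pmin \<le> p i"
  proof -
    show "pmin \<le> p i" for i by (simp add: pmin_eq)
    from this [of undefined] show "pmin \<le> 1" using p_range [of undefined] by linarith
    have "pmin \<in> range p" unfolding pmin_eq by (rule Min_in) auto
    then show "0 \<le> pmin" using p_range by (auto intro: less_imp_le)
  qed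
  \<comment> \<open>One iteration, conditionally on the history \<open>h\<close>: all blocks that could be drawn next are
    considered together.\<close>
  have "(\<Sum>i\<in>UNIV. p i * G (h @ [i])) \<le> q * G h" for h
  proof -
    have h: "composite f (separable b \<Psi>) (x h) \<noteq> \<infinity>" using fin by (simp add: Fe)
    have "\<exists>\<theta> d. \<theta>lo \<le> \<theta> \<and> \<theta> \<le> c \<and> is_block_direction b grad \<Psi> \<theta> (x h) i d \<and>
        sufficient_decrease F \<sigma> (x h) d \<and> x (h @ [i]) = x h + d" for i
      using rnbpg_stepE [OF step [of h i] h params(1,3)] \<theta>_le unfolding Fe by metis
    then obtain \<theta> d where \<theta>: "\<And>i. \<theta>lo \<le> \<theta> i" "\<And>i. \<theta> i \<le> c"
      and d: "\<And>i. is_block_direction b grad \<Psi> (\<theta> i) (x h) i (d i)"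
      and dec: "\<And>i. sufficient_decrease F \<sigma> (x h) (d i)"
      and next_x: "\<And>i. x (h @ [i]) = x h + d i"
      by metis
    define a where "a = (\<lambda>i. real_of_ereal (F (x h)) - real_of_ereal (F (x h + d i)))"
    let ?D = "\<Sum>i\<in>UNIV. (norm (d i))\<^sup>2"
    have a_ge: "\<sigma> / 2 * (norm (d i))\<^sup>2 \<le> a i" for i
      using dec [of i] sufficient_decrease_iff [OF h] by (simp add: a_def Fe)
    have "0 \<le> Lf" unfolding Lf_eq by (intro sum_nonneg less_imp_le L_pos)
    then have "(c * \<tau>\<^sup>2 * (max 1 c)\<^sup>2 / 2 + (Lmax - \<theta>lo) / 2) * ?D \<le> varpi * ?D"
      unfolding varpi_eq using params c by (intro mult_right_mono rnbpg_varpi_ge sum_nonneg) auto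
    moreover have "G h - (c * \<tau>\<^sup>2 * (max 1 c)\<^sup>2 / 2 + (Lmax - \<theta>lo) / 2) * ?D
        \<le> (\<Sum>i\<in>UNIV. a i)"
      unfolding G_def a_def Fstar_eq Fe
    proof (rule sum_block_decrease_ge [OF h _ c(2) _ d _ \<theta> Lmax ghat])
      show "minimizers (composite f (separable b \<Psi>)) \<noteq> {}" using solvable by (simp add: Fe)
      show "infdist (x h) (minimizers (composite f (separable b \<Psi>))) \<le> \<tau> * norm (ghat h)"
        using error_bound by (simp add: Fe)
    qed (use params tau_pos in auto)
    ultimately have total: "G h - varpi * ?D \<le> (\<Sum>i\<in>UNIV. a i)" by linarith
    have "G h - (\<Sum>i\<in>UNIV. p i * a i) \<le> q * G h"
      unfolding q_def using a_ge pmin varpi_nonneg params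
      by (intro weighted_sum_le_contraction [OF _ _ _ _ _ _ total]) auto
    moreover have "(\<Sum>i\<in>UNIV. p i * G (h @ [i])) = (\<Sum>i\<in>UNIV. p i * G h - p i * a i)"
      by (intro sum.cong) (simp_all add: G_def a_def next_x algebra_simps)
    then have "(\<Sum>i\<in>UNIV. p i * G (h @ [i])) = G h - (\<Sum>i\<in>UNIV. p i * a i)"
      by (simp add: sum_subtractf sum_distrib_right [symmetric] p_sum)
    ultimately show ?thesis by simp
  qed
  moreover have "0 \<le> q"
    unfolding q_def using varpi_nonneg params pmin by (intro divide_nonneg_pos) auto
  ultimately have "(\<Sum>h | length h = k. prod_list (map p h) * G h) \<le> q ^ k * G []"
    using p_range by (intro weighted_sum_geometric_decay) (auto intro: less_imp_le)
  moreover have "(\<Sum>h | length h = k. prod_list (map p h) * G h)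
      = expectation (\<lambda>w. real_of_ereal (F (x (map (\<lambda>t. I t w) [0..<k])))) - Fstar"
    unfolding expectation_history [OF indep law, where G = "\<lambda>h. real_of_ereal (F (x h))"]
    by (simp add: G_def right_diff_distrib sum_subtractf sum_distrib_right [symmetric]
        sum_prod_list_eq_1 [OF p_sum])
  ultimately show ?thesis by (simp add: G_def q_def)
qed

end
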